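(* If $L$ is a latin square of order $n \geq 5$, then $c(G(L)) = 3$.
   Context: A latin square $L$ of order $n$ is an $n\times n$ array with entries from a set of $n$ symbols such that each symbol occurs exactly once in each row and in each column. The latin square graph $G(L)$ is the graph whose $n^2$ vertices are the cells of $L$, where two distinct cells are adjacent if they share a row, share a column, or contain the same symbol. Cops and Robbers on a graph $G$: first the cops choose vertices, then the robber chooses a vertex; thereafter the cops and the robber alternate turns, and on a turn each player moves to an adjacent vertex or stays put. All positions are visible to everyone. The cops win if after finitely many rounds some cop lands on the robber's vertex; otherwise the robber wins. The cop number $c(G)$ is the least number of cops for which the cops have a winning strategy. *)

theory Defs
  imports "Graph_Theory.Pair_Digraph"
begin

definition latin_square :: "nat \<Rightarrow> 'a set \<Rightarrow> (nat \<Rightarrow> nat \<Rightarrow> 'a) \<Rightarrow> bool" where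
  "latin_square n S L \<longleftrightarrow>
     finite S \<and> card S = n \<and>
     (\<forall>i<n. \<forall>j<n. L i j \<in> S) \<and>
     (\<forall>i<n. \<forall>s\<in>S. \<exists>!j. j < n \<and> L i j = s) \<and>
     (\<forall>j<n. \<forall>s\<in>S. \<exists>!i. i < n \<and> L i j = s)"

text \<open>
  A finite simple graph is a \<^const>\<open>pair_graph\<close>: a symmetric, loop-free, finite arc relation.
\<close>

definition latin_square_graph :: "nat \<Rightarrow> (nat \<Rightarrow> nat \<Rightarrow> 'a) \<Rightarrow> (nat \<times> nat) pair_pre_digraph" where
  "latin_square_graph n L =
     \<lparr> pverts = {..<n} \<times> {..<n},
       parcs = {((i, j), (i', j')) | i j i' j'.
                  i < n \<and> j < n \<and> i' < n \<and> j' < n \<and> (i, j) \<noteq> (i', j') \<and>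
                  (i = i' \<or> j = j' \<or> L i j = L i' j')} \<rparr>"

lemma pair_graph_latin_square_graph: "pair_graph (latin_square_graph n L)"
proof -
  have fin: "finite (parcs (latin_square_graph n L))"
    by (rule finite_subset[of _ "({..<n} \<times> {..<n}) \<times> ({..<n} \<times> {..<n})"])
       (auto simp: latin_square_graph_def)
  have "sym (parcs (latin_square_graph n L))"
    unfolding sym_def latin_square_graph_def by auto
  then have "symmetric (with_proj (latin_square_graph n L))"
    by (simp add: symmetric_def)
  with fin show ?thesis
    by unfold_locales (auto simp: latin_square_graph_def)
qed

definition legal_move :: "'v pair_pre_digraph \<Rightarrow> 'v \<Rightarrow> 'v \<Rightarrow> bool" where
  "legal_move G u v \<longleftrightarrow> u \<in> pverts G \<and> v \<in> pverts G \<and> (u = v \<or> u \<rightarrow>\<^bsub>G\<^esub> v)"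

text \<open>
  A play of the robber: \<open>r 0\<close> is the initial choice, \<open>r (Suc t)\<close> the position after
  the robber's move in round \<open>Suc t\<close>.
\<close>

definition robber_play :: "'v pair_pre_digraph \<Rightarrow> (nat \<Rightarrow> 'v) \<Rightarrow> bool" where
  "robber_play G r \<longleftrightarrow> r 0 \<in> pverts G \<and> (\<forall>t. legal_move G (r t) (r (Suc t)))"

text \<open>
  A strategy assigns to every history of robber positions the cops' positions (cops are numbered
  \<open>0, 1, \<dots>\<close>). It may depend on the whole history; the cops' own past moves are determined
  by the strategy and that history. The positions are chosen in the order
  \<open>cop_pos \<sigma> r 0\<close>, \<open>r 0\<close>, \<open>cop_pos \<sigma> r 1\<close>, \<open>r 1\<close>, \<dots>, so \<open>cop_pos \<sigma> r t\<close> uses only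
  \<open>r 0, \<dots>, r (t - 1)\<close>.
\<close>

type_synonym 'v cop_strategy = "'v list \<Rightarrow> nat \<Rightarrow> 'v"

definition cop_pos :: "'v cop_strategy \<Rightarrow> (nat \<Rightarrow> 'v) \<Rightarrow> nat \<Rightarrow> nat \<Rightarrow> 'v" where
  "cop_pos \<sigma> r t = \<sigma> (map r [0..<t])"

text \<open>
  Legality is also asked for rounds after a capture; this is harmless, since the cops
  may stay put from then on.
\<close>

definition legal_strategy :: "'v pair_pre_digraph \<Rightarrow> nat \<Rightarrow> 'v cop_strategy \<Rightarrow> bool" where
  "legal_strategy G k \<sigma> \<longleftrightarrow>
     (\<forall>r. robber_play G r \<longrightarrow>
        (\<forall>i<k. cop_pos \<sigma> r 0 i \<in> pverts G \<and>
               (\<forall>t. legal_move G (cop_pos \<sigma> r t i) (cop_pos \<sigma> r (Suc t) i))))"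

text \<open>
  The robber is caught when sharing a vertex with a cop, after either the robber's or the cops' turn.
\<close>

definition caught :: "nat \<Rightarrow> 'v cop_strategy \<Rightarrow> (nat \<Rightarrow> 'v) \<Rightarrow> bool" where
  "caught k \<sigma> r \<longleftrightarrow> (\<exists>t. \<exists>i<k. cop_pos \<sigma> r t i = r t \<or> cop_pos \<sigma> r (Suc t) i = r t)"

definition cops_win :: "'v pair_pre_digraph \<Rightarrow> nat \<Rightarrow> bool" where
  "cops_win G k \<longleftrightarrow>
     (\<exists>\<sigma>. legal_strategy G k \<sigma> \<and> (\<forall>r. robber_play G r \<longrightarrow> caught k \<sigma> r))"

definition cop_number :: "'v pair_pre_digraph \<Rightarrow> nat" where
  "cop_number G = (LEAST k. cops_win G k)"

text \<open>On a finite graph the minimum is attained: one cop per vertex suffices.\<close>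

lemma cops_win_card_pverts:
  assumes "finite (pverts G)"
  shows "cops_win G (card (pverts G))"
proof -
  obtain f where f: "bij_betw f {..<card (pverts G)} (pverts G)"
    using ex_bij_betw_nat_finite[OF assms] by (auto simp: atLeast0LessThan)
  have V: "f i \<in> pverts G" if "i < card (pverts G)" for i
    using f that by (auto dest: bij_betwE)
  have "caught (card (pverts G)) (\<lambda>_. f) r" if r: "robber_play G r" for r
  proof -
    have "r 0 \<in> f ` {..<card (pverts G)}"
      using r f by (simp add: robber_play_def bij_betw_def)
    then obtain i where "i < card (pverts G)" "f i = r 0"
      by auto
    then show ?thesis
      unfolding caught_def cop_pos_def by blast
  qed
  moreover have "legal_strategy G (card (pverts G)) (\<lambda>_. f)"
    using V by (auto simp: legal_strategy_def cop_pos_def legal_move_def)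
  ultimately show ?thesis
    unfolding cops_win_def by blast
qed

end

theory Submission
  imports Defs
begin

text \<open>
  Through every cell pass three lines: its row, its column and the set of cells with its symbol.
  Two lines of different kinds meet in exactly one cell. Hence a cop reaches any prescribed line in
  one move, and three cops can occupy the three lines through the robber's cell; wherever the
  robber goes next, he stays on one of these lines and is caught. Two cops different from the
  robber's cell leave one of the three lines through it free of cops, and each cop threatens at
  most two cells of a line that he is not on. So for \<open>n > 4\<close> the robber has a safe cell on that line.
\<close>

section \<open>Evading the cops\<close>

text \<open>Turns a rule \<open>f\<close>, which chooses the next position from the list of earlier
  ones, into an infinite play. As the cops' positions are a function of the robber's history, a
  robber who reacts to them is given by such a rule.\<close>

function responsive_play :: "('v list \<Rightarrow> 'v) \<Rightarrow> nat \<Rightarrow> 'v" where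
  "responsive_play f t = f (map (responsive_play f) [0..<t])"
  by auto
termination by (relation "measure snd") auto

declare responsive_play.simps [simp del]

text \<open>The robber keeps the invariant that after his turn no cop has a legal move onto him. The
  next cop turn then cannot capture him, and \<open>move\<close> restores the invariant.\<close>

lemma not_cops_win_if_evasive:
  assumes start: "\<And>c. \<exists>v\<in>pverts G. \<forall>i<k. \<not> legal_move G (c i) v"
    and move: "\<And>c v. v \<in> pverts G \<Longrightarrow> \<forall>i<k. c i \<noteq> v \<Longrightarrow>
      \<exists>u. legal_move G v u \<and> (\<forall>i<k. \<not> legal_move G (c i) u)"
  shows "\<not> cops_win G k"
proof
  assume "cops_win G k"
  then obtain \<sigma> where legal: "legal_strategy G k \<sigma>"
    and win: "\<And>r. robber_play G r \<Longrightarrow> caught k \<sigma> r"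
    unfolding cops_win_def by blast
  define s where "s c = (SOME v. v \<in> pverts G \<and> (\<forall>i<k. \<not> legal_move G (c i) v))" for c
  have s: "s c \<in> pverts G \<and> (\<forall>i<k. \<not> legal_move G (c i) (s c))" for c
    unfolding s_def by (rule someI_ex) (use start in blast)
  \<comment> \<open>A legal move is chosen even when a cop stands on \<open>v\<close>. Thus the play
    is legal before any evasion is proved, and only against legal plays does
    \<open>legal_strategy\<close> make the cops' moves legal.\<close>
  define m where "m c v = (SOME u. legal_move G v u \<and>
      ((\<forall>i<k. c i \<noteq> v) \<longrightarrow> (\<forall>i<k. \<not> legal_move G (c i) u)))" for c v
  have m: "legal_move G v (m c v) \<and>
      ((\<forall>i<k. c i \<noteq> v) \<longrightarrow> (\<forall>i<k. \<not> legal_move G (c i) (m c v)))"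
    if "v \<in> pverts G" for c v
    unfolding m_def
  proof (rule someI_ex)
    show "\<exists>u. legal_move G v u \<and>
      ((\<forall>i<k. c i \<noteq> v) \<longrightarrow> (\<forall>i<k. \<not> legal_move G (c i) u))"
    proof (cases "\<forall>i<k. c i \<noteq> v")
      case True
      then show ?thesis using move[OF that] by blast
    next
      case False
      then show ?thesis using that by (auto simp: legal_move_def)
    qed
  qed
  \<comment> \<open>The cops' positions just before the robber's choice are
    \<open>\<sigma> h\<close>, so both the start and every later move react to the current
    configuration.\<close>
  define f where "f h = (if h = [] then s (\<sigma> h) else m (\<sigma> h) (last h))" for h
  define r where "r = responsive_play f"
  have r0: "r 0 = s (cop_pos \<sigma> r 0)"
    unfolding r_def cop_pos_def by (subst responsive_play.simps) (simp add: f_def)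
  have rSuc: "r (Suc t) = m (cop_pos \<sigma> r (Suc t)) (r t)" for t
    unfolding r_def cop_pos_def by (subst responsive_play.simps) (simp add: f_def)
  have rV: "r t \<in> pverts G" for t
    by (induction t) (use r0 s rSuc m in \<open>auto simp: legal_move_def\<close>)
  have play: "robber_play G r"
    unfolding robber_play_def using rV rSuc m by simp
  have cop_move: "legal_move G (cop_pos \<sigma> r t i) (cop_pos \<sigma> r (Suc t) i)" if "i < k" for t i
    using legal play that unfolding legal_strategy_def by blast
  have safe: "\<forall>i<k. \<not> legal_move G (cop_pos \<sigma> r t i) (r t)" for t
  proof (induction t)
    case 0
    then show ?case using r0 s by simp
  next
    case (Suc t)
    then have "\<forall>i<k. cop_pos \<sigma> r (Suc t) i \<noteq> r t"
      using cop_move by metis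
    then show ?case using rSuc m[OF rV] by simp
  qed
  \<comment> \<open>Both forms of capture contradict \<open>safe\<close>: a cop already at
    \<open>r t\<close> could stay put there, and a cop arriving at \<open>r t\<close> makes a legal
    move.\<close>
  have "\<not> caught k \<sigma> r"
    unfolding caught_def using safe cop_move rV by (metis legal_move_def)
  with win[OF play] show False by blast
qed

section \<open>Lines of a latin square\<close>

text \<open>Numbering the three kinds of lines as directions allows uniform proofs and counting over
  directions. Every \<open>d\<close> from 2 on means equal symbols, hence the bounds
  \<open>d < 3\<close> below.\<close>

definition collinear :: "(nat \<Rightarrow> nat \<Rightarrow> 'a) \<Rightarrow> nat \<Rightarrow> nat \<times> nat \<Rightarrow> nat \<times> nat \<Rightarrow> bool" where
  "collinear L d p q \<longleftrightarrow>
     (if d = 0 then fst p = fst q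
      else if d = 1 then snd p = snd q
      else L (fst p) (snd p) = L (fst q) (snd q))"

lemma collinear_sym: "collinear L d p q \<Longrightarrow> collinear L d q p"
  by (auto simp: collinear_def split: if_splits)

lemma collinear_trans: "collinear L d p q \<Longrightarrow> collinear L d q s \<Longrightarrow> collinear L d p s"
  by (auto simp: collinear_def split: if_splits)

lemma pverts_latin_square_graph [simp]: "pverts (latin_square_graph n L) = {..<n} \<times> {..<n}"
  by (simp add: latin_square_graph_def)

lemma ex_less_3: "(\<exists>d<3. P d) \<longleftrightarrow> P 0 \<or> P 1 \<or> P (2::nat)"
  by (auto simp: numeral_3_eq_3 numeral_2_eq_2 less_Suc_eq)

text \<open>Staying put needs no separate case, because \<open>collinear\<close> is
  reflexive.\<close>

lemma legal_move_latin_square_graph: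
  "legal_move (latin_square_graph n L) p q \<longleftrightarrow>
     p \<in> {..<n} \<times> {..<n} \<and> q \<in> {..<n} \<times> {..<n} \<and> (\<exists>d<3. collinear L d p q)"
  unfolding ex_less_3
  by (cases p; cases q) (auto simp: legal_move_def latin_square_graph_def collinear_def)

lemma latin_square_row_unique:
  assumes "latin_square n S L" "i < n" "j < n" "j' < n" "L i j = L i j'"
  shows "j = j'"
  using assms unfolding latin_square_def by metis

lemma latin_square_col_unique:
  assumes "latin_square n S L" "j < n" "i < n" "i' < n" "L i j = L i' j"
  shows "i = i'"
  using assms unfolding latin_square_def by metis

lemma latin_square_ex_col:
  assumes "latin_square n S L" "i < n" "j < n" "i' < n"
  shows "\<exists>j'<n. L i' j' = L i j"
  using assms unfolding latin_square_def by metis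

lemma collinear_two_directions_eq:
  assumes "latin_square n S L" "p \<in> {..<n} \<times> {..<n}" "q \<in> {..<n} \<times> {..<n}"
    and "d < 3" "e < 3" "d \<noteq> e" "collinear L d p q" "collinear L e p q"
  shows "p = q"
proof -
  obtain i j where p: "p = (i, j)" by force
  obtain i' j' where q: "q = (i', j')" by force
  have "d \<in> {0, 1, 2}" "e \<in> {0, 1, 2}" using assms(4,5) by auto
  then show ?thesis
    using assms latin_square_row_unique[OF assms(1), of i j j']
      latin_square_col_unique[OF assms(1), of j i i']
    by (auto simp: p q collinear_def)
qed

lemma card_line_ge:
  assumes L: "latin_square n S L" and p: "p \<in> {..<n} \<times> {..<n}"
  shows "n \<le> card {q \<in> {..<n} \<times> {..<n}. collinear L d p q}" (is "n \<le> card ?A")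
proof -
  obtain i j where ij: "p = (i, j)" "i < n" "j < n" using p by force
  obtain g where g: "inj_on g {..<n}" "g ` {..<n} \<subseteq> ?A"
  proof (cases "d = 0")
    case True
    show thesis
      by (rule that[of "\<lambda>x. (i, x)"]) (use True ij in \<open>auto simp: collinear_def inj_on_def\<close>)
  next
    case d0: False
    show thesis
    proof (cases "d = 1")
      case True
      show thesis
        by (rule that[of "\<lambda>x. (x, j)"]) (use True ij in \<open>auto simp: collinear_def inj_on_def\<close>)
    next
      case False
      \<comment> \<open>A symbol line is parametrised by its rows: each row contains the symbol of
        \<open>p\<close>.\<close>
      have "\<forall>x\<in>{..<n}. \<exists>y<n. L x y = L i j"
        using latin_square_ex_col[OF L ij(2,3)] by simp
      then obtain h where "\<forall>x\<in>{..<n}. h x < n \<and> L x (h x) = L i j"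
        by metis
      then show thesis
        by (intro that[of "\<lambda>x. (x, h x)"])
          (use d0 False ij in \<open>auto simp: collinear_def inj_on_def\<close>)
    qed
  qed
  have "card {..<n} \<le> card ?A"
    by (rule card_inj_on_le[OF g]) (auto intro: finite_subset[of _ "{..<n} \<times> {..<n}"])
  then show ?thesis by simp
qed

text \<open>A cop off the line attacks it only along the two directions other than \<open>d\<close>,
  at most one cell for each. So at most \<open>2 * k\<close> of its at least \<open>n\<close> cells
  are attacked. Cops outside the board attack nothing, so \<open>free\<close> constrains only those
  on it.\<close>

lemma ex_safe_on_cop_free_line:
  fixes c :: "nat \<Rightarrow> nat \<times> nat"
  assumes L: "latin_square n S L" and n: "2 * k < n"
    and p: "p \<in> {..<n} \<times> {..<n}" and d: "d < 3"
    and free: "\<And>i. i < k \<Longrightarrow> c i \<in> {..<n} \<times> {..<n} \<Longrightarrow> \<not> collinear L d p (c i)"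
  shows "\<exists>q. q \<in> {..<n} \<times> {..<n} \<and> collinear L d p q \<and>
    (\<forall>i<k. \<not> legal_move (latin_square_graph n L) (c i) q)"
proof (rule ccontr)
  assume neg: "\<not> ?thesis"
  define A where "A = {q \<in> {..<n} \<times> {..<n}. collinear L d p q}"
  \<comment> \<open>For \<open>x = (i, e)\<close> these are the cells of the line that cop
    \<open>i\<close> attacks along direction \<open>e\<close>.\<close>
  define B where "B x = {q \<in> A. collinear L (snd x) (c (fst x)) q \<and> c (fst x) \<in> {..<n} \<times> {..<n}}"
    for x
  define I where "I = {..<k} \<times> ({..<3} - {d})"
  have "A \<subseteq> (\<Union>x\<in>I. B x)"
  proof
    fix q assume q: "q \<in> A"
    then obtain i where i: "i < k" "legal_move (latin_square_graph n L) (c i) q"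
      using neg unfolding A_def by blast
    then obtain e where e: "c i \<in> {..<n} \<times> {..<n}" "e < 3" "collinear L e (c i) q"
      unfolding legal_move_latin_square_graph by metis
    have "e \<noteq> d"
    proof
      assume "e = d"
      then have "collinear L d p (c i)"
        using collinear_trans[OF _ collinear_sym[OF e(3)]] q by (simp add: A_def)
      with free[OF i(1) e(1)] show False ..
    qed
    then have "(i, e) \<in> I" "q \<in> B (i, e)"
      using i e q by (auto simp: I_def B_def)
    then show "q \<in> (\<Union>x\<in>I. B x)" by blast
  qed
  moreover have "finite I" by (simp add: I_def)
  moreover have finA: "finite A"
    by (rule finite_subset[of _ "{..<n} \<times> {..<n}"]) (auto simp: A_def)
  then have finB: "finite (B x)" for x
    by (rule rev_finite_subset) (auto simp: B_def)
  ultimately have "card A \<le> card (\<Union>x\<in>I. B x)"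
    by (intro card_mono) auto
  also have "\<dots> \<le> (\<Sum>x\<in>I. card (B x))"
    by (rule card_UN_le) (simp add: I_def)
  also have "\<dots> \<le> (\<Sum>x\<in>I. 1)"
  proof (rule sum_mono)
    fix x assume x: "x \<in> I"
    \<comment> \<open>Two such cells would be collinear in direction \<open>d\<close> and in the
      different direction \<open>snd x\<close>.\<close>
    have "y = z" if "y \<in> B x" "z \<in> B x" for y z
    proof (rule collinear_two_directions_eq[OF L, of y z d "snd x"])
      have "collinear L d p y" "collinear L d p z"
        using that by (simp_all add: A_def B_def)
      then show "collinear L d y z" by (rule collinear_trans[OF collinear_sym])
      have "collinear L (snd x) (c (fst x)) y" "collinear L (snd x) (c (fst x)) z"
        using that by (simp_all add: B_def)
      then show "collinear L (snd x) y z" by (rule collinear_trans[OF collinear_sym])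
    qed (use that x d in \<open>auto simp: A_def B_def I_def\<close>)
    then show "card (B x) \<le> 1"
      using finB by (simp add: card_le_Suc0_iff_eq)
  qed
  also have "\<dots> = k * 2" using d by (simp add: I_def)
  finally have "card A \<le> k * 2" .
  moreover have "n \<le> card A" unfolding A_def by (rule card_line_ge[OF L p])
  ultimately show False using n by simp
qed

section \<open>The two bounds\<close>

lemma not_cops_win_latin_square_graph:
  assumes L: "latin_square n S L" and n: "2 * k < n" and k: "k < 3"
  shows "\<not> cops_win (latin_square_graph n L) k"
proof (rule not_cops_win_if_evasive)
  fix c :: "nat \<Rightarrow> nat \<times> nat"
  \<comment> \<open>Fewer than \<open>n\<close> cops leave some row \<open>a\<close> empty; the
    robber starts on a safe cell of it.\<close>
  have "card ((\<lambda>i. fst (c i)) ` {..<k}) < card {..<n}"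
    using card_image_le[of "{..<k}" "\<lambda>i. fst (c i)"] n by simp
  then have "\<not> {..<n} \<subseteq> (\<lambda>i. fst (c i)) ` {..<k}"
    using card_mono[of "(\<lambda>i. fst (c i)) ` {..<k}" "{..<n}"] by auto
  then obtain a where "a < n" "\<forall>i<k. fst (c i) \<noteq> a" by blast
  then have "\<exists>q. q \<in> {..<n} \<times> {..<n} \<and> collinear L 0 (a, 0) q \<and>
    (\<forall>i<k. \<not> legal_move (latin_square_graph n L) (c i) q)"
    by (intro ex_safe_on_cop_free_line[OF L n]) (auto simp: collinear_def)
  then show "\<exists>v\<in>pverts (latin_square_graph n L).
      \<forall>i<k. \<not> legal_move (latin_square_graph n L) (c i) v"
    by auto
next
  fix c :: "nat \<Rightarrow> nat \<times> nat" and v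
  assume "v \<in> pverts (latin_square_graph n L)" and ne: "\<forall>i<k. c i \<noteq> v"
  then have v: "v \<in> {..<n} \<times> {..<n}" by simp
  \<comment> \<open>Pigeonhole: were all three lines through \<open>v\<close> occupied by fewer than
    three cops, one cop would be on two of them and therefore at \<open>v\<close>.\<close>
  have "\<exists>d<3. \<forall>i<k. c i \<in> {..<n} \<times> {..<n} \<longrightarrow> \<not> collinear L d v (c i)"
  proof (rule ccontr)
    assume "\<not> ?thesis"
    then have "\<forall>d\<in>{..<3}. \<exists>i. i < k \<and> c i \<in> {..<n} \<times> {..<n} \<and> collinear L d v (c i)"
      by auto
    then obtain g where
      g: "\<forall>d\<in>{..<3}. g d < k \<and> c (g d) \<in> {..<n} \<times> {..<n} \<and> collinear L d v (c (g d))"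
      by metis
    then have "g ` {..<3} \<subseteq> {..<k}" by auto
    then have "\<not> inj_on g {..<3}"
      using card_inj_on_le[of g "{..<3}" "{..<k}"] k by auto
    then obtain d e where de: "d < 3" "e < 3" "d \<noteq> e" "g d = g e"
      by (auto simp: inj_on_def)
    then have "v = c (g d)"
      using collinear_two_directions_eq[OF L v, of "c (g d)" d e] g lessThan_iff by metis
    then show False using g de(1) ne lessThan_iff by metis
  qed
  then obtain d where "d < 3" "\<forall>i<k. c i \<in> {..<n} \<times> {..<n} \<longrightarrow> \<not> collinear L d v (c i)"
    by blast
  then show "\<exists>u. legal_move (latin_square_graph n L) v u \<and>
      (\<forall>i<k. \<not> legal_move (latin_square_graph n L) (c i) u)"
    using ex_safe_on_cop_free_line[OF L n v, of d c] v
    unfolding legal_move_latin_square_graph[of n L v] by blast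
qed

text \<open>All cops start at \<open>(0, 0)\<close>. Once \<open>r 0\<close> is known, cop
  \<open>d\<close> moves onto the line of direction \<open>d\<close> through it. The robber's move
  to \<open>r 1\<close> follows one of these lines, and the cop there captures him.\<close>

lemma cops_win_latin_square_graph_3:
  assumes L: "latin_square n S L" and n: "0 < n"
  shows "cops_win (latin_square_graph n L) 3"
proof -
  let ?G = "latin_square_graph n L"
  have ex: "\<exists>q. legal_move ?G (0, 0) q \<and> collinear L d v q"
    if v: "v \<in> {..<n} \<times> {..<n}" for d v
  proof -
    obtain i j where ij: "v = (i, j)" "i < n" "j < n" using v by force
    obtain j' where j': "j' < n" "L 0 j' = L i j"
      using latin_square_ex_col[OF L ij(2,3) n] by blast
    \<comment> \<open>The line through \<open>v\<close> is met in column 0 if it is a row, and in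
      row 0 otherwise; both are within one move of \<open>(0, 0)\<close>.\<close>
    define q where "q = (if d = 0 then (i, 0) else if d = 1 then (0, j) else (0, j'))"
    have "legal_move ?G (0, 0) q" "collinear L d v q"
      unfolding legal_move_latin_square_graph ex_less_3
      using ij j' n by (auto simp: q_def collinear_def)
    then show ?thesis by blast
  qed
  define w where "w d v = (SOME q. legal_move ?G (0, 0) q \<and> collinear L d v q)" for d v
  have w: "legal_move ?G (0, 0) (w d v) \<and> collinear L d v (w d v)"
    if "v \<in> {..<n} \<times> {..<n}" for d v
    unfolding w_def using ex[OF that] by (rule someI_ex)
  \<comment> \<open>Only the first two robber positions matter: a cop who cannot reach
    \<open>r 1\<close> stays where he is, and from time 2 on no cop moves. The test on
    \<open>length h\<close> keeps \<open>h ! 1\<close> from being read too early.\<close>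
  define \<sigma> where "\<sigma> h d =
      (if h = [] then (0, 0) else if length h = 1 \<or> \<not> legal_move ?G (w d (h ! 0)) (h ! 1)
       then w d (h ! 0) else h ! 1)" for h d
  have pos0: "cop_pos \<sigma> r 0 d = (0, 0)" for r d
    by (simp add: cop_pos_def \<sigma>_def)
  have pos1: "cop_pos \<sigma> r (Suc 0) d = w d (r 0)" for r d
    by (simp add: cop_pos_def \<sigma>_def)
  have pos2: "cop_pos \<sigma> r (Suc (Suc t)) d =
      (if legal_move ?G (w d (r 0)) (r 1) then r 1 else w d (r 0))" for r t d
  proof -
    have "map r [0..<Suc (Suc t)] ! 0 = r 0" "map r [0..<Suc (Suc t)] ! 1 = r 1"
      by (simp_all del: upt_Suc)
    then show ?thesis by (simp add: cop_pos_def \<sigma>_def del: upt_Suc)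
  qed
  have "legal_strategy ?G 3 \<sigma>"
    unfolding legal_strategy_def
  proof (intro allI impI conjI)
    fix r d t assume r: "robber_play ?G r"
    show "cop_pos \<sigma> r 0 d \<in> pverts ?G" using n by (simp add: pos0)
    have r0: "r 0 \<in> {..<n} \<times> {..<n}" using r by (simp add: robber_play_def)
    consider "t = 0" | "t = Suc 0" | t' where "t = Suc (Suc t')"
      by (cases t rule: nat.exhaust; cases "t - 1" rule: nat.exhaust) auto
    then show "legal_move ?G (cop_pos \<sigma> r t d) (cop_pos \<sigma> r (Suc t) d)"
    proof cases
      case 1
      then show ?thesis using w[OF r0] by (simp add: pos0 pos1)
    qed (use w[OF r0, of d] in \<open>auto simp: pos1 pos2 legal_move_def split: if_splits\<close>)
  qed
  moreover have "caught 3 \<sigma> r" if r: "robber_play ?G r" for r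
  proof -
    have r0: "r 0 \<in> {..<n} \<times> {..<n}" and "legal_move ?G (r 0) (r 1)"
      using r by (simp_all add: robber_play_def)
    then obtain d where d: "d < 3" "collinear L d (r 0) (r 1)" and r1: "r 1 \<in> {..<n} \<times> {..<n}"
      unfolding legal_move_latin_square_graph by metis
    have "collinear L d (w d (r 0)) (r 1)"
      using collinear_trans[OF collinear_sym d(2)] w[OF r0] by simp
    then have "legal_move ?G (w d (r 0)) (r 1)"
      using w[OF r0, of d] d(1) r1 by (simp only: legal_move_latin_square_graph) metis
    \<comment> \<open>This is the second alternative in \<open>caught\<close> at time 1, a capture
      on the cops' turn.\<close>
    then have "cop_pos \<sigma> r (Suc 1) d = r 1" by (simp add: pos2)
    then have "cop_pos \<sigma> r (Suc 1) d = r 1 \<and> d < 3" using d(1) by simp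
    then show ?thesis unfolding caught_def by blast
  qed
  ultimately show ?thesis unfolding cops_win_def by blast
qed

theorem corollary2p3:
  fixes n :: nat and S :: "'a set" and L :: "nat \<Rightarrow> nat \<Rightarrow> 'a"
  assumes "latin_square n S L" and "n \<ge> 5"
  shows "cop_number (latin_square_graph n L) = 3"
  unfolding cop_number_def
proof (rule Least_equality)
  show "cops_win (latin_square_graph n L) 3"
    using cops_win_latin_square_graph_3[OF assms(1)] assms(2) by simp
next
  fix k assume "cops_win (latin_square_graph n L) k"
  then show "3 \<le> k"
    using not_cops_win_latin_square_graph[OF assms(1), of k] assms(2) by linarith
qed

end
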